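(* Let $n\in\mathbb N$, let $P$ and $N$ be finite index sets, and let $(X_i^{(1)})_{i\in P},\dots,(X_i^{(n)})_{i\in P},(X_i)_{i\in P}$ and $(Y_j^{(1)})_{j\in N},\dots,(Y_j^{(n)})_{j\in N},(Y_j)_{j\in N}$ be families of subsets of $\mathcal D$. Then $$\bigcap_{i\in P}\big((X_i^{(1)},\dots,X_i^{(n)})\to X_i\big)\ \subseteq\ \bigcup_{j\in N}\big((Y_j^{(1)},\dots,Y_j^{(n)})\to Y_j\big)$$ if and only if there exists $j_0\in N$ such that for every map $\iota:P\to\{1,\dots,n+1\}$, $$\Big(\exists k\in\iota(P),\ k\le n,\ \ Y_{j_0}^{(k)}\subseteq\bigcup_{\{i\in P\mid\iota(i)=k\}}X_i^{(k)}\Big)\quad\text{or}\quad\Big(\bigcap_{\{i\in P\mid\iota(i)=n+1\}}X_i\subseteq Y_{j_0}\Big).$$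
   Context: $\mathcal D$ is a set (the domain of the interpretation of types), $\Omega$ and $\mho$ are two distinct elements not in $\mathcal D$; $\mathcal D_\Omega=\mathcal D\cup\{\Omega\}$, $\mathcal D_\mho=\mathcal D\cup\{\mho\}$. $\mathcal P_f(S)$ denotes the set of finite subsets of $S$. For $X_1,\dots,X_n,Y\subseteq\mathcal D$ define $$(X_1,\dots,X_n)\to Y=\Big\{R\in\mathcal P_f(\mathcal D_\mho^n\times\mathcal D_\Omega)\ \Big|\ \forall((\iota_1,\dots,\iota_n),\delta)\in R.\ \big(\forall i=1..n.\ \iota_i\in X_i\text{ or }\iota_i=\mho\big)\Rightarrow\delta\in Y\Big\}.$$ $\iota(P)$ is the image of $\iota$. Conventions: the intersection over an empty index set of codomain sets $X_i$ (second disjunct) is $\mathcal D_\Omega$; the intersection of arrow sets over an empty $P$ is $\mathcal P_f(\mathcal D_\mho^n\times\mathcal D_\Omega)$. *)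

theory Defs
  imports Main "HOL-Library.FuncSet"
begin

text \<open>
  The domain \<open>D\<close> is a subset of an ambient type in which \<open>\<Omega>\<close> and \<open>mho\<close> also live.
  An n-tuple over a set is an extensional function on \<open>{1..n}\<close>; for \<open>n = 0\<close> there is
  exactly one.
\<close>

definition rels :: "'a set \<Rightarrow> 'a \<Rightarrow> 'a \<Rightarrow> nat \<Rightarrow> ((nat \<Rightarrow> 'a) \<times> 'a) set set" where
  "rels D \<Omega> mho n = Fpow (({1..n} \<rightarrow>\<^sub>E insert mho D) \<times> insert \<Omega> D)"

text \<open>\<open>arrow D \<Omega> mho n X Y\<close> is \<open>(X 1, \<dots>, X n) \<rightarrow> Y\<close>; values of \<open>X\<close> outside \<open>{1..n}\<close> are irrelevant.\<close>

definition arrow ::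
  "'a set \<Rightarrow> 'a \<Rightarrow> 'a \<Rightarrow> nat \<Rightarrow> (nat \<Rightarrow> 'a set) \<Rightarrow> 'a set \<Rightarrow> ((nat \<Rightarrow> 'a) \<times> 'a) set set" where
  "arrow D \<Omega> mho n X Y =
     {R \<in> rels D \<Omega> mho n.
        \<forall>(x, \<delta>) \<in> R. (\<forall>i\<in>{1..n}. x i \<in> X i \<or> x i = mho) \<longrightarrow> \<delta> \<in> Y}"

text \<open>
  Intersection of a family of subsets of \<open>U\<close>, which is \<open>U\<close> for the empty family
  (the plain intersection of an empty family would be the whole type).
\<close>

definition Inter_in :: "'b set \<Rightarrow> ('i \<Rightarrow> 'b set) \<Rightarrow> 'i set \<Rightarrow> 'b set" where
  "Inter_in U A I = U \<inter> (\<Inter>i\<in>I. A i)"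

end

theory Submission
  imports Defs
begin

text \<open>
  Membership of a relation in an arrow set is decided pair by pair, so the inclusion fails as soon
  as every \<open>j \<in> N\<close> has a pair violating the \<open>j\<close>-th arrow but no arrow in \<open>P\<close>: the finite set of
  these pairs then lies on the left and not on the right. A pair \<open>((x\<^sub>1, \<dots>, x\<^sub>n), \<delta>)\<close> satisfies
  the \<open>i\<close>-th arrow either because some argument \<open>x\<^sub>k\<close> is neither \<open>\<mho>\<close> nor in the \<open>k\<close>-th domain, or
  because \<open>\<delta>\<close> lies in the codomain; a map \<open>\<iota>\<close> records this choice, with \<open>n + 1\<close> standing for the
  codomain. Positions that \<open>\<iota>\<close> does not use can be filled with \<open>\<mho>\<close>, and \<open>\<delta>\<close> with \<open>\<Omega>\<close>.
\<close>

definition satisfies ::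
  "'a \<Rightarrow> nat \<Rightarrow> (nat \<Rightarrow> 'a set) \<Rightarrow> 'a set \<Rightarrow> (nat \<Rightarrow> 'a) \<times> 'a \<Rightarrow> bool" where
  "satisfies mho n X Y p \<longleftrightarrow>
     ((\<forall>k\<in>{1..n}. fst p k \<in> X k \<or> fst p k = mho) \<longrightarrow> snd p \<in> Y)"

lemma arrow_iff_satisfies:
  "R \<in> arrow D \<Omega> mho n X Y \<longleftrightarrow> R \<in> rels D \<Omega> mho n \<and> (\<forall>p\<in>R. satisfies mho n X Y p)"
  by (simp add: arrow_def satisfies_def case_prod_beta)

text \<open>The purpose is to make one \<open>j\<close> serve all relations uniformly: afterwards no
  sets of pairs remain, and each \<open>j\<close> can be studied alone.\<close>

lemma Inter_arrow_subset_Union_arrow_iff: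
  assumes "finite N"
  shows "Inter_in (rels D \<Omega> mho n) (\<lambda>i. arrow D \<Omega> mho n (Xs i) (X i)) P
           \<subseteq> (\<Union>j\<in>N. arrow D \<Omega> mho n (Ys j) (Y j))
         \<longleftrightarrow>
         (\<exists>j\<in>N. \<forall>p \<in> ({1..n} \<rightarrow>\<^sub>E insert mho D) \<times> insert \<Omega> D.
            (\<forall>i\<in>P. satisfies mho n (Xs i) (X i) p) \<longrightarrow> satisfies mho n (Ys j) (Y j) p)"
    (is "?L \<subseteq> ?R \<longleftrightarrow> (\<exists>j\<in>N. \<forall>p\<in>?U. ?A p \<longrightarrow> ?B j p)")
proof
  assume sub: "?L \<subseteq> ?R"
  show "\<exists>j\<in>N. \<forall>p\<in>?U. ?A p \<longrightarrow> ?B j p"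
  proof (rule ccontr)
    assume "\<not> ?thesis"
    then have "\<forall>j\<in>N. \<exists>p. p \<in> ?U \<and> ?A p \<and> \<not> ?B j p"
      by blast
    then obtain p where p: "\<And>j. j \<in> N \<Longrightarrow> p j \<in> ?U \<and> ?A (p j) \<and> \<not> ?B j (p j)"
      by metis
    \<comment> \<open>Finiteness of \<open>N\<close> makes this image a legitimate relation. For
      empty \<open>N\<close> it is the empty relation, which lies in every arrow set but not in the
      empty union.\<close>
    have "p ` N \<in> rels D \<Omega> mho n"
      unfolding rels_def Fpow_def using p \<open>finite N\<close> by blast
    then have "p ` N \<in> ?L"
      using p by (simp add: Inter_in_def arrow_iff_satisfies)
    with sub obtain j where "j \<in> N" "p ` N \<in> arrow D \<Omega> mho n (Ys j) (Y j)"
      by blast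
    with p show False
      unfolding arrow_iff_satisfies by blast
  qed
next
  assume "\<exists>j\<in>N. \<forall>p\<in>?U. ?A p \<longrightarrow> ?B j p"
  then obtain j where j: "j \<in> N" and imp: "\<And>p. p \<in> ?U \<Longrightarrow> ?A p \<Longrightarrow> ?B j p"
    by blast
  show "?L \<subseteq> ?R"
  proof
    fix R assume "R \<in> ?L"
    then have R: "R \<in> rels D \<Omega> mho n" and sat: "\<And>p. p \<in> R \<Longrightarrow> ?A p"
      by (simp_all add: Inter_in_def arrow_iff_satisfies)
    from R have "R \<subseteq> ?U"
      unfolding rels_def Fpow_def by blast
    with imp sat R have "R \<in> arrow D \<Omega> mho n (Ys j) (Y j)"
      unfolding arrow_iff_satisfies by blast
    with j show "R \<in> ?R"
      by blast
  qed
qed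

text \<open>Both directions are contrapositive: from a map \<open>\<iota>\<close> failing both
  disjuncts one builds a pair in \<open>?U\<close> with \<open>?A\<close> but not \<open>?B\<close>,
  and from such a pair one reads off such a map.\<close>

lemma satisfies_implication_iff:
  assumes "mho \<notin> D" and "\<And>k. k \<in> {1..n} \<Longrightarrow> Z k \<subseteq> D"
  shows "(\<forall>p \<in> ({1..n} \<rightarrow>\<^sub>E insert mho D) \<times> insert \<Omega> D.
            (\<forall>i\<in>P. satisfies mho n (Xs i) (X i) p) \<longrightarrow> satisfies mho n Z W p)
         \<longleftrightarrow>
         (\<forall>\<iota> \<in> P \<rightarrow>\<^sub>E {1..n + 1}.
            (\<exists>k \<in> \<iota> ` P. k \<le> n \<and> Z k \<subseteq> (\<Union>i\<in>{i \<in> P. \<iota> i = k}. Xs i k)) \<or>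
            Inter_in (insert \<Omega> D) X {i \<in> P. \<iota> i = n + 1} \<subseteq> W)"
    (is "(\<forall>p\<in>?U. ?A p \<longrightarrow> ?B p) \<longleftrightarrow> (\<forall>\<iota> \<in> ?M. ?C \<iota> \<or> ?E \<iota>)")
proof
  assume imp: "\<forall>p\<in>?U. ?A p \<longrightarrow> ?B p"
  show "\<forall>\<iota> \<in> ?M. ?C \<iota> \<or> ?E \<iota>"
  proof (intro ballI, rule ccontr)
    fix \<iota> assume \<iota>: "\<iota> \<in> ?M" and neg: "\<not> (?C \<iota> \<or> ?E \<iota>)"
    then obtain \<delta> where \<delta>: "\<delta> \<in> Inter_in (insert \<Omega> D) X {i \<in> P. \<iota> i = n + 1}" "\<delta> \<notin> W"
      by blast
    have "\<forall>k\<in>{k \<in> \<iota> ` P. k \<le> n}. \<exists>z. z \<in> Z k \<and> z \<notin> (\<Union>i\<in>{i \<in> P. \<iota> i = k}. Xs i k)"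
      using neg by (simp only: de_Morgan_disj subset_iff) blast
    from bchoice[OF this] obtain z where "\<forall>k\<in>{k \<in> \<iota> ` P. k \<le> n}.
        z k \<in> Z k \<and> z k \<notin> (\<Union>i\<in>{i \<in> P. \<iota> i = k}. Xs i k)" ..
    then have z: "\<And>k. k \<in> \<iota> ` P \<Longrightarrow> k \<le> n \<Longrightarrow> z k \<in> Z k"
      and z': "\<And>i. i \<in> P \<Longrightarrow> \<iota> i \<le> n \<Longrightarrow> z (\<iota> i) \<notin> Xs i (\<iota> i)"
      by auto
    \<comment> \<open>At a position outside the image of \<open>\<iota>\<close> the set
      \<open>Z k\<close> may be empty, so no point of it can be demanded; \<open>mho\<close> meets
      the premise of the target arrow there regardless.\<close>
    define x where "x = (\<lambda>k\<in>{1..n}. if k \<in> \<iota> ` P then z k else mho)"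
    have zD: "z k \<in> D" if "k \<in> \<iota> ` P" "k \<in> {1..n}" for k
      using that z assms(2) by auto
    have "(x, \<delta>) \<in> ?U"
      using zD \<delta> by (auto simp: x_def Inter_in_def)
    moreover have "satisfies mho n (Xs i) (X i) (x, \<delta>)" if i: "i \<in> P" for i
    proof (cases "\<iota> i = n + 1")
      case True
      then show ?thesis
        using \<delta> i by (auto simp: satisfies_def Inter_in_def)
    next
      case False
      moreover have "\<iota> i \<in> {1..n + 1}"
        using \<iota> i by blast
      ultimately have k: "\<iota> i \<in> {1..n}"
        by auto
      \<comment> \<open>Since \<open>z\<close> takes its values in \<open>D\<close>, it avoids
        \<open>mho\<close>; so position \<open>\<iota> i\<close> falsifies the premise of the
        \<open>i\<close>-th arrow.\<close>
      then have "x (\<iota> i) = z (\<iota> i)" "z (\<iota> i) \<notin> Xs i (\<iota> i)" "z (\<iota> i) \<noteq> mho"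
        using i z' zD[of "\<iota> i"] assms(1) by (auto simp: x_def)
      then show ?thesis
        using k unfolding satisfies_def fst_conv by metis
    qed
    ultimately have "?B (x, \<delta>)"
      using imp by blast
    moreover have "\<not> ?B (x, \<delta>)"
      using z \<delta> by (auto simp: satisfies_def x_def)
    ultimately show False
      by contradiction
  qed
next
  assume choice: "\<forall>\<iota> \<in> ?M. ?C \<iota> \<or> ?E \<iota>"
  show "\<forall>p\<in>?U. ?A p \<longrightarrow> ?B p"
  proof (intro ballI impI, rule ccontr)
    fix p assume p: "p \<in> ?U" "?A p" "\<not> ?B p"
    obtain x \<delta> where px: "p = (x, \<delta>)"
      by (cases p)
    have x: "\<And>k. k \<in> {1..n} \<Longrightarrow> x k \<in> Z k \<or> x k = mho" and \<delta>: "\<delta> \<in> insert \<Omega> D" "\<delta> \<notin> W"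
      using p px by (auto simp: satisfies_def)
    \<comment> \<open>The two ways of satisfying an arrow are merged into one formula in
      \<open>k\<close>, so that a single choice function \<open>c\<close> yields the map
      \<open>\<iota>\<close>.\<close>
    have "\<forall>i\<in>P. \<exists>k. k \<in> {1..n + 1} \<and>
            (if k = n + 1 then \<delta> \<in> X i else x k \<notin> Xs i k \<and> x k \<noteq> mho)"
    proof
      fix i assume "i \<in> P"
      then have "\<delta> \<in> X i \<or> (\<exists>k\<in>{1..n}. x k \<notin> Xs i k \<and> x k \<noteq> mho)"
        using p px by (auto simp: satisfies_def)
      then show "\<exists>k. k \<in> {1..n + 1} \<and>
            (if k = n + 1 then \<delta> \<in> X i else x k \<notin> Xs i k \<and> x k \<noteq> mho)"
      proof (elim disjE bexE conjE)
        assume "\<delta> \<in> X i"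
        then show ?thesis
          by (intro exI[of _ "n + 1"]) simp
      next
        fix k assume "k \<in> {1..n}" "x k \<notin> Xs i k" "x k \<noteq> mho"
        then show ?thesis
          by (intro exI[of _ k]) simp
      qed
    qed
    then obtain c where c: "\<And>i. i \<in> P \<Longrightarrow> c i \<in> {1..n + 1} \<and>
            (if c i = n + 1 then \<delta> \<in> X i else x (c i) \<notin> Xs i (c i) \<and> x (c i) \<noteq> mho)"
      by metis
    define \<iota> where "\<iota> = restrict c P"
    have "\<iota> \<in> ?M"
      using c by (simp add: \<iota>_def)
    then have "?C \<iota> \<or> ?E \<iota>"
      using choice by blast
    then show False
    proof
      assume "?C \<iota>"
      then obtain i where i: "i \<in> P" "c i \<le> n"
          and sub: "Z (c i) \<subseteq> (\<Union>i'\<in>{i' \<in> P. \<iota> i' = c i}. Xs i' (c i))"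
        by (auto simp: \<iota>_def)
      \<comment> \<open>The choice of \<open>c i\<close> rules out \<open>mho\<close>. The covering
        then puts this point into some \<open>Xs i' (c i)\<close> with \<open>c i' = c i\<close>,
        against the choice of \<open>c i'\<close>.\<close>
      have "x (c i) \<in> Z (c i)"
        using x[of "c i"] c[OF i(1)] i(2) by auto
      then obtain i' where "i' \<in> P" "c i' = c i" "x (c i) \<in> Xs i' (c i)"
        using sub by (auto simp: \<iota>_def)
      then show False
        using c[of i'] i(2) by auto
    next
      assume "?E \<iota>"
      \<comment> \<open>If no index is sent to \<open>n + 1\<close>, this only says that
        \<open>\<delta>\<close> lies in \<open>insert \<Omega> D\<close>.\<close>
      moreover have "\<delta> \<in> Inter_in (insert \<Omega> D) X {i \<in> P. \<iota> i = n + 1}"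
        using c \<delta> by (force simp: Inter_in_def \<iota>_def)
      ultimately show False
        using \<delta> by blast
    qed
  qed
qed

theorem theorem4p1:
  fixes D :: "'a set" and \<Omega> mho :: 'a and n :: nat
    and P :: "'p set" and N :: "'q set"
    and Xs :: "'p \<Rightarrow> nat \<Rightarrow> 'a set" and X :: "'p \<Rightarrow> 'a set"
    and Ys :: "'q \<Rightarrow> nat \<Rightarrow> 'a set" and Y :: "'q \<Rightarrow> 'a set"
  assumes "\<Omega> \<noteq> mho" and "\<Omega> \<notin> D" and "mho \<notin> D"
    and "finite P" and "finite N"
    and "\<And>i k. i \<in> P \<Longrightarrow> k \<in> {1..n} \<Longrightarrow> Xs i k \<subseteq> D"
    and "\<And>i. i \<in> P \<Longrightarrow> X i \<subseteq> D"
    and "\<And>j k. j \<in> N \<Longrightarrow> k \<in> {1..n} \<Longrightarrow> Ys j k \<subseteq> D"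
    and "\<And>j. j \<in> N \<Longrightarrow> Y j \<subseteq> D"
  shows "Inter_in (rels D \<Omega> mho n) (\<lambda>i. arrow D \<Omega> mho n (Xs i) (X i)) P
           \<subseteq> (\<Union>j\<in>N. arrow D \<Omega> mho n (Ys j) (Y j))
         \<longleftrightarrow>
         (\<exists>j0\<in>N. \<forall>\<iota> \<in> P \<rightarrow>\<^sub>E {1..n + 1}.
            (\<exists>k \<in> \<iota> ` P. k \<le> n \<and> Ys j0 k \<subseteq> (\<Union>i\<in>{i \<in> P. \<iota> i = k}. Xs i k)) \<or>
            Inter_in (insert \<Omega> D) X {i \<in> P. \<iota> i = n + 1} \<subseteq> Y j0)"
proof -
  have "(\<forall>p \<in> ({1..n} \<rightarrow>\<^sub>E insert mho D) \<times> insert \<Omega> D.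
            (\<forall>i\<in>P. satisfies mho n (Xs i) (X i) p) \<longrightarrow> satisfies mho n (Ys j) (Y j) p)
         \<longleftrightarrow>
         (\<forall>\<iota> \<in> P \<rightarrow>\<^sub>E {1..n + 1}.
            (\<exists>k \<in> \<iota> ` P. k \<le> n \<and> Ys j k \<subseteq> (\<Union>i\<in>{i \<in> P. \<iota> i = k}. Xs i k)) \<or>
            Inter_in (insert \<Omega> D) X {i \<in> P. \<iota> i = n + 1} \<subseteq> Y j)" if "j \<in> N" for j
    using that assms by (intro satisfies_implication_iff) auto
  then show ?thesis
    unfolding Inter_arrow_subset_Union_arrow_iff[OF \<open>finite N\<close>] by (rule bex_cong[OF refl])
qed

end
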